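(* Let $G$ be a finite group. Then there are integers $a,b\ge 0$ with $$\mathbb{B}_G\;\cong\;\mathbb{Z}^a\times(\mathbb{Z}/2\mathbb{Z})^b .$$ The copies of $\mathbb{Z}/2\mathbb{Z}$ are given by those elements whose reduced form $[\hat\gamma_1,\ldots,\hat\gamma_q]_G$ has the property that $\gamma_i$ is conjugate to $\gamma_i^{-1}$ in $G$ for every $i=1,\ldots,q$ (that is, these are exactly the elements $\alpha\in\mathbb{B}_G$ with $2\alpha=0$).
   Context: For a finite group $G$ and $\gamma\in G$, $\hat\gamma$ denotes the conjugacy class of $\gamma$ in $G$ and $\hat\gamma^{-1}$ the conjugacy class of $\gamma^{-1}$. Let $\Lambda_G$ be the commutative monoid of unordered tuples $[\hat\gamma_1,\ldots,\hat\gamma_q]_G$ ($q\ge 0$) of conjugacy classes of $G$ with $\gamma_1\cdots\gamma_q\in[G,G]$ (the commutator subgroup), where tuples differing only by entries equal to the class of $1$ are identified; the addition $\oplus$ is concatenation of tuples and the zero element is the empty tuple. Define $\mathbb{B}_G:=\Lambda_G/\langle[\hat\gamma,\hat\gamma^{-1}]_G : \gamma\in G\rangle$, the quotient of the monoid by the indicated submonoid (two elements $a,b$ are identified if $a\oplus z=b\oplus z'$ with $z,z'$ in the submonoid). It is an abelian group with $-[\hat\gamma_1,\ldots,\hat\gamma_q]_G=[\hat\gamma_1^{-1},\ldots,\hat\gamma_q^{-1}]_G$. A tuple is in reduced form if it has no entry equal to the class of $1$ and contains no cancelling pair, i.e. no two entries at positions $i\neq j$ with $\hat\gamma_i=\hat\gamma_j^{-1}$;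 every element of $\mathbb{B}_G$ is brought to its reduced form by deleting cancelling pairs. *)

theory Defs
  imports
    "HOL-Algebra.Algebra"
    "HOL-Library.Multiset"
begin

definition submonoid_generated :: "('a, 'b) monoid_scheme \<Rightarrow> 'a set \<Rightarrow> 'a set" where
  "submonoid_generated M S = \<Inter> {H. submonoid H M \<and> S \<subseteq> H}"

definition monoid_quot_rel :: "('a, 'b) monoid_scheme \<Rightarrow> 'a set \<Rightarrow> ('a \<times> 'a) set" where
  "monoid_quot_rel M N =
     {(a, b). a \<in> carrier M \<and> b \<in> carrier M \<and> (\<exists>z\<in>N. \<exists>z'\<in>N. a \<otimes>\<^bsub>M\<^esub> z = b \<otimes>\<^bsub>M\<^esub> z')}"

definition monoid_quot :: "('a, 'b) monoid_scheme \<Rightarrow> 'a set \<Rightarrow> 'a set monoid" where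
  "monoid_quot M N =
     \<lparr>carrier = carrier M // monoid_quot_rel M N,
      monoid.mult = (\<lambda>A B. \<Union>a\<in>A. \<Union>b\<in>B. monoid_quot_rel M N `` {a \<otimes>\<^bsub>M\<^esub> b}),
      one = monoid_quot_rel M N `` {\<one>\<^bsub>M\<^esub>}\<rparr>"

definition conj_class :: "('a, 'b) monoid_scheme \<Rightarrow> 'a \<Rightarrow> 'a set" where
  "conj_class G x =
     orbit G (\<lambda>g. \<lambda>h\<in>carrier G. g \<otimes>\<^bsub>G\<^esub> h \<otimes>\<^bsub>G\<^esub> inv\<^bsub>G\<^esub> g) x"

text \<open>
  Unordered tuples are multisets of classes. Whether the product lies in the commutator
  subgroup depends neither on the order of the entries nor on the representatives
  (lemma \<open>in_T_iff\<close> below).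
\<close>

definition class_tuple_monoid :: "('a, 'b) monoid_scheme \<Rightarrow> 'a set multiset monoid" where
  "class_tuple_monoid G =
     \<lparr>carrier = {mset (map (conj_class G) xs) | xs.
                  set xs \<subseteq> carrier G \<and>
                  foldr (\<otimes>\<^bsub>G\<^esub>) xs \<one>\<^bsub>G\<^esub> \<in> derived G (carrier G)},
      monoid.mult = (+),
      one = {#}\<rparr>"

text \<open>
  Dividing by the submonoid generated by the one-entry tuple of the class of the identity
  identifies two tuples exactly when they differ only by entries equal to that class.
\<close>

definition trivial_tuples :: "('a, 'b) monoid_scheme \<Rightarrow> 'a set multiset set" where
  "trivial_tuples G =
     submonoid_generated (class_tuple_monoid G) {{#conj_class G \<one>\<^bsub>G\<^esub>#}}"

definition Lambda_monoid :: "('a, 'b) monoid_scheme \<Rightarrow> 'a set multiset set monoid" where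
  "Lambda_monoid G = monoid_quot (class_tuple_monoid G) (trivial_tuples G)"

definition Lambda_class :: "('a, 'b) monoid_scheme \<Rightarrow> 'a set multiset \<Rightarrow> 'a set multiset set" where
  "Lambda_class G M = monoid_quot_rel (class_tuple_monoid G) (trivial_tuples G) `` {M}"

definition cancelling_pair :: "('a, 'b) monoid_scheme \<Rightarrow> 'a \<Rightarrow> 'a set multiset" where
  "cancelling_pair G x = {#conj_class G x, conj_class G (inv\<^bsub>G\<^esub> x)#}"

definition cancelling_elements :: "('a, 'b) monoid_scheme \<Rightarrow> 'a set multiset set set" where
  "cancelling_elements G =
     submonoid_generated (Lambda_monoid G)
       {Lambda_class G (cancelling_pair G x) | x. x \<in> carrier G}"

definition B_group :: "('a, 'b) monoid_scheme \<Rightarrow> 'a set multiset set set monoid" where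
  "B_group G = monoid_quot (Lambda_monoid G) (cancelling_elements G)"

definition B_class :: "('a, 'b) monoid_scheme \<Rightarrow> 'a set multiset \<Rightarrow> 'a set multiset set set" where
  "B_class G M = monoid_quot_rel (Lambda_monoid G) (cancelling_elements G) `` {Lambda_class G M}"

text \<open>
  Multiset inclusion expresses that the cancelling entries sit at two distinct positions:
  a class that is its own inverse is allowed to occur once, but not twice.
\<close>

definition reduced_tuple :: "('a, 'b) monoid_scheme \<Rightarrow> 'a set multiset \<Rightarrow> bool" where
  "reduced_tuple G M \<longleftrightarrow>
     conj_class G \<one>\<^bsub>G\<^esub> \<notin># M \<and> (\<forall>x\<in>carrier G. \<not> cancelling_pair G x \<subseteq># M)"

text \<open>
  The lemma \<open>ex1_reduced_form\<close> below shows that the description determines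
  exactly one tuple for every element of the carrier.
\<close>

definition reduced_form :: "('a, 'b) monoid_scheme \<Rightarrow> 'a set multiset set set \<Rightarrow> 'a set multiset" where
  "reduced_form G \<alpha> =
     (THE M. M \<in> carrier (class_tuple_monoid G) \<and> reduced_tuple G M \<and> B_class G M = \<alpha>)"

definition self_inverse_tuple :: "('a, 'b) monoid_scheme \<Rightarrow> 'a set multiset \<Rightarrow> bool" where
  "self_inverse_tuple G M \<longleftrightarrow>
     (\<forall>x\<in>carrier G. conj_class G x \<in># M \<longrightarrow> inv\<^bsub>G\<^esub> x \<in> conj_class G x)"


lemma submonoid_generated_incl: "x \<in> S \<Longrightarrow> x \<in> submonoid_generated M S"
  unfolding submonoid_generated_def by auto

lemma submonoid_generated_least:
  assumes "submonoid H M" "S \<subseteq> H" shows "submonoid_generated M S \<subseteq> H"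
  using assms unfolding submonoid_generated_def by auto

lemma submonoid_generated_submonoid:
  assumes "monoid M" "S \<subseteq> carrier M" shows "submonoid (submonoid_generated M S) M"
proof -
  have c: "submonoid (carrier M) M"
    using assms(1) by (simp add: submonoid_def monoid.m_closed monoid.one_closed)
  show ?thesis
  proof (rule submonoid.intro)
    show "submonoid_generated M S \<subseteq> carrier M"
      using submonoid_generated_least[OF c assms(2)] .
  qed (auto simp: submonoid_generated_def submonoid_def)
qed

locale comm_monoid_submonoid = comm_monoid M + submonoid N M for M (structure) and N
begin

abbreviation (input) "R \<equiv> monoid_quot_rel M N"

lemma Ncar: "z \<in> N \<Longrightarrow> z \<in> carrier M"
  using subset by auto

lemma equiv_R: "equiv (carrier M) R"
proof (rule equivI)
  show "R \<subseteq> carrier M \<times> carrier M" by (auto simp: monoid_quot_rel_def)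
  show "refl_on (carrier M) R"
    by (auto simp: monoid_quot_rel_def refl_on_def intro!: bexI[of _ \<one>] one_closed)
  show "sym R" by (auto simp: monoid_quot_rel_def sym_def) metis
  show "trans R"
  proof (rule transI)
    fix a b c assume "(a, b) \<in> R" "(b, c) \<in> R"
    then obtain z z' w w' where *: "a \<in> carrier M" "b \<in> carrier M" "c \<in> carrier M"
      "z \<in> N" "z' \<in> N" "w \<in> N" "w' \<in> N" "a \<otimes> z = b \<otimes> z'" "b \<otimes> w = c \<otimes> w'"
      by (auto simp: monoid_quot_rel_def)
    have "a \<otimes> (z \<otimes> w) = b \<otimes> z' \<otimes> w"
      using * Ncar by (simp add: m_assoc[symmetric])
    also have "\<dots> = b \<otimes> w \<otimes> z'" using *(1-7) Ncar by (simp add: m_ac)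
    also have "\<dots> = c \<otimes> (w' \<otimes> z')" unfolding \<open>b \<otimes> w = c \<otimes> w'\<close> using * Ncar by (simp add: m_assoc)
    finally have eq: "a \<otimes> (z \<otimes> w) = c \<otimes> (w' \<otimes> z')" .
    have "z \<otimes> w \<in> N" "w' \<otimes> z' \<in> N" using * by auto
    with eq have "\<exists>u\<in>N. \<exists>v\<in>N. a \<otimes> u = c \<otimes> v" by blast
    then show "(a, c) \<in> R" using * by (simp add: monoid_quot_rel_def)
  qed
qed

lemma R_mult:
  assumes "(a, a') \<in> R" "(b, b') \<in> R" shows "(a \<otimes> b, a' \<otimes> b') \<in> R"
proof -
  obtain z z' w w' where *: "a \<in> carrier M" "b \<in> carrier M" "a' \<in> carrier M" "b' \<in> carrier M"
      "z \<in> N" "z' \<in> N" "w \<in> N" "w' \<in> N" "a \<otimes> z = a' \<otimes> z'" "b \<otimes> w = b' \<otimes> w'"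
    using assms by (auto simp: monoid_quot_rel_def)
  have "a \<otimes> b \<otimes> (z \<otimes> w) = (a \<otimes> z) \<otimes> (b \<otimes> w)" using *(1-8) Ncar by (simp add: m_ac)
  also have "\<dots> = (a' \<otimes> z') \<otimes> (b' \<otimes> w')" using *(9,10) by simp
  also have "\<dots> = a' \<otimes> b' \<otimes> (z' \<otimes> w')" using *(1-8) Ncar by (simp add: m_ac)
  finally have eq: "a \<otimes> b \<otimes> (z \<otimes> w) = a' \<otimes> b' \<otimes> (z' \<otimes> w')" .
  have "z \<otimes> w \<in> N" "z' \<otimes> w' \<in> N" using * by auto
  with eq have "\<exists>u\<in>N. \<exists>v\<in>N. a \<otimes> b \<otimes> u = a' \<otimes> b' \<otimes> v" by blast
  then show ?thesis using * by (simp add: monoid_quot_rel_def)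
qed

lemma quot_mult:
  assumes "a \<in> carrier M" "b \<in> carrier M"
  shows "R `` {a} \<otimes>\<^bsub>monoid_quot M N\<^esub> R `` {b} = R `` {a \<otimes> b}"
proof -
  have r: "(a, a) \<in> R" "(b, b) \<in> R"
    using assms equiv_R by (meson equiv_def refl_onD)+
  have e: "R `` {a' \<otimes> b'} = R `` {a \<otimes> b}" if "(a, a') \<in> R" "(b, b') \<in> R" for a' b'
    using equiv_class_eq[OF equiv_R R_mult[OF that]] by (rule sym)
  have "(\<Union>a'\<in>R `` {a}. \<Union>b'\<in>R `` {b}. R `` {a' \<otimes> b'}) = R `` {a \<otimes> b}"
  proof (rule equalityI)
    show "(\<Union>a'\<in>R `` {a}. \<Union>b'\<in>R `` {b}. R `` {a' \<otimes> b'}) \<subseteq> R `` {a \<otimes> b}"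
      using e by blast
    show "R `` {a \<otimes> b} \<subseteq> (\<Union>a'\<in>R `` {a}. \<Union>b'\<in>R `` {b}. R `` {a' \<otimes> b'})"
      using r by blast
  qed
  then show ?thesis by (simp add: monoid_quot_def)
qed

lemma quot_carrier: "carrier (monoid_quot M N) = (\<lambda>a. R `` {a}) ` carrier M"
  by (auto simp: monoid_quot_def quotient_def)

lemma quot_one: "\<one>\<^bsub>monoid_quot M N\<^esub> = R `` {\<one>}"
  by (simp add: monoid_quot_def)

lemma quot_eq_iff:
  assumes "a \<in> carrier M" "b \<in> carrier M"
  shows "R `` {a} = R `` {b} \<longleftrightarrow> (\<exists>z\<in>N. \<exists>z'\<in>N. a \<otimes> z = b \<otimes> z')"
proof -
  have "R `` {a} = R `` {b} \<longleftrightarrow> (a, b) \<in> R" by (rule eq_equiv_class_iff[OF equiv_R assms])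
  also have "\<dots> \<longleftrightarrow> (\<exists>z\<in>N. \<exists>z'\<in>N. a \<otimes> z = b \<otimes> z')"
    using assms by (simp add: monoid_quot_rel_def)
  finally show ?thesis .
qed

lemma comm_monoid_quot: "comm_monoid (monoid_quot M N)"
proof (rule comm_monoidI)
  fix x y assume "x \<in> carrier (monoid_quot M N)" "y \<in> carrier (monoid_quot M N)"
  then obtain a b where ab: "a \<in> carrier M" "x = R `` {a}" "b \<in> carrier M" "y = R `` {b}"
    unfolding quot_carrier by blast
  show "x \<otimes>\<^bsub>monoid_quot M N\<^esub> y \<in> carrier (monoid_quot M N)"
    unfolding ab quot_mult[OF ab(1,3)] quot_carrier using ab by (intro imageI) simp
  show "x \<otimes>\<^bsub>monoid_quot M N\<^esub> y = y \<otimes>\<^bsub>monoid_quot M N\<^esub> x"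
    unfolding ab quot_mult[OF ab(1,3)] quot_mult[OF ab(3,1)] using m_comm[OF ab(1,3)] by (rule arg_cong)
  show "\<one>\<^bsub>monoid_quot M N\<^esub> \<otimes>\<^bsub>monoid_quot M N\<^esub> x = x"
    unfolding quot_one ab using quot_mult[OF comm_monoid.axioms(1)[THEN monoid.one_closed] ab(1)]
      comm_monoid_axioms ab(1) by simp
  fix z assume "z \<in> carrier (monoid_quot M N)"
  then obtain c where c: "c \<in> carrier M" "z = R `` {c}"
    unfolding quot_carrier by blast
  have 1: "a \<otimes> b \<in> carrier M" "b \<otimes> c \<in> carrier M" using ab c by simp_all
  show "x \<otimes>\<^bsub>monoid_quot M N\<^esub> y \<otimes>\<^bsub>monoid_quot M N\<^esub> z =
      x \<otimes>\<^bsub>monoid_quot M N\<^esub> (y \<otimes>\<^bsub>monoid_quot M N\<^esub> z)"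
    unfolding ab c quot_mult[OF ab(1,3)] quot_mult[OF ab(3) c(1)] quot_mult[OF 1(1) c(1)]
      quot_mult[OF ab(1) 1(2)] using m_assoc[OF ab(1,3) c(1)] by (rule arg_cong)
next
  have "\<one> \<in> carrier M" by simp
  then show "\<one>\<^bsub>monoid_quot M N\<^esub> \<in> carrier (monoid_quot M N)"
    unfolding quot_one quot_carrier by (rule imageI)
qed

end

lemma image_mset_eq_mset: "image_mset f Y = mset ws \<Longrightarrow> \<exists>zs. mset zs = Y \<and> map f zs = ws"
proof (induction ws arbitrary: Y)
  case Nil
  then have "Y = {#}" by simp
  then show ?case by (intro exI[of _ "[]"]) simp
next
  case (Cons w ws)
  from Cons.prems have "image_mset f Y = add_mset w (mset ws)" by simp
  then obtain Y' a where Y: "Y = add_mset a Y'" "f a = w" "image_mset f Y' = mset ws"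
    by (metis msed_map_invR add_mset_add_single)
  with Cons.IH[of Y'] obtain zs where "mset zs = Y'" "map f zs = ws" by blast
  then show ?case
    using Y(1,2) by (intro exI[of _ "a # zs"]) simp
qed

lemma ex_map_of_set_subset:
  assumes "set ws \<subseteq> f ` S" shows "\<exists>xs. set xs \<subseteq> S \<and> ws = map f xs"
proof (intro exI conjI)
  show "set (map (inv_into S f) ws) \<subseteq> S"
    using assms inv_into_into[of _ f S] by (auto simp: subset_iff)
  have "f (inv_into S f w) = w" if "w \<in> set ws" for w
    using assms that by (meson f_inv_into_f subsetD)
  then show "ws = map f (map (inv_into S f) ws)"
    by (simp add: map_idI)
qed

abbreviation (input) class_inv :: "('a, 'b) monoid_scheme \<Rightarrow> 'a set \<Rightarrow> 'a set" where
  "class_inv G c \<equiv> (\<lambda>x. inv\<^bsub>G\<^esub> x) ` c"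

context group
begin

context
begin

private abbreviation (input) "cc \<equiv> conj_class G"
private abbreviation (input) "T \<equiv> class_tuple_monoid G"
private abbreviation (input) "pr xs \<equiv> foldr (\<otimes>) xs \<one>"

interpretation conj: group_action G "carrier G" "\<lambda>g. \<lambda>h\<in>carrier G. g \<otimes> h \<otimes> inv g"
  by (rule action_by_conjugation)

lemma conj_class_eq:
  assumes "x \<in> carrier G" shows "cc x = {g \<otimes> x \<otimes> inv g | g. g \<in> carrier G}"
  using assms by (auto simp: conj_class_def orbit_def)

lemma conj_class_refl: "x \<in> carrier G \<Longrightarrow> x \<in> cc x"
  unfolding conj_class_def by (rule conj.orbit_refl)

lemma class_inv_conj_class:
  assumes "x \<in> carrier G" shows "class_inv G (cc x) = cc (inv x)"
proof -
  have "inv (g \<otimes> x \<otimes> inv g) = g \<otimes> inv x \<otimes> inv g" if "g \<in> carrier G" for g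
    using assms that by (simp add: inv_mult_group m_assoc)
  then show ?thesis using assms by (auto simp: conj_class_eq image_iff) metis+
qed

lemma conj_class_inv_cong:
  assumes "x \<in> carrier G" "y \<in> carrier G" "cc x = cc y" shows "cc (inv x) = cc (inv y)"
  using class_inv_conj_class[OF assms(1)] class_inv_conj_class[OF assms(2)] assms(3) by simp

lemma conj_class_one: "cc \<one> = {\<one>}"
  by (auto simp: conj_class_eq intro!: exI[of _ \<one>])

private abbreviation (input) "D \<equiv> derived G (carrier G)"
private abbreviation (input) "A \<equiv> G Mod D"
private abbreviation (input) "h \<equiv> \<lambda>x. D #> x"

lemma comm_group_A: "comm_group A" by (rule derived_quot_is_comm_group)

lemma h_hom: "group_hom G A h"
  by (intro group_hom.intro group_hom_axioms.intro is_group derived_quot_is_group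
        normal.r_coset_hom_Mod derived_self_is_normal)

lemma h_one_iff: "x \<in> carrier G \<Longrightarrow> h x = \<one>\<^bsub>A\<^esub> \<longleftrightarrow> x \<in> D"
proof -
  assume x: "x \<in> carrier G"
  have s: "subgroup D G" by (rule derived_is_subgroup) simp
  have "\<one>\<^bsub>A\<^esub> = D" by (simp add: FactGroup_def)
  then show ?thesis
    using x s by (metis coset_join1 coset_join2 subgroup.subset)
qed

lemma h_pr:
  assumes "set xs \<subseteq> carrier G"
  shows "h (pr xs) = foldr (\<otimes>\<^bsub>A\<^esub>) (map h xs) \<one>\<^bsub>A\<^esub>"
  using assms
proof (induction xs)
  case Nil then show ?case using group_hom.hom_one[OF h_hom] by simp
next
  case (Cons x xs) then show ?case using group_hom.hom_mult[OF h_hom, of x "pr xs"] by simp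
qed

lemma h_cc:
  assumes "x \<in> carrier G" "y \<in> cc x" shows "h y = h x"
proof -
  interpret A: comm_group A by (rule comm_group_A)
  interpret h: group_hom G A h by (rule h_hom)
  obtain g where g: "g \<in> carrier G" "y = g \<otimes> x \<otimes> inv g" using assms by (auto simp: conj_class_eq)
  have "h y = h g \<otimes>\<^bsub>A\<^esub> h x \<otimes>\<^bsub>A\<^esub> inv\<^bsub>A\<^esub> h g" using g assms by simp
  also have "\<dots> = h x \<otimes>\<^bsub>A\<^esub> (h g \<otimes>\<^bsub>A\<^esub> inv\<^bsub>A\<^esub> h g)"
    using g assms h.hom_closed by (metis A.inv_closed A.m_assoc A.m_comm)
  also have "\<dots> = h x" using g assms h.hom_closed by (metis A.r_inv A.r_one)
  finally show ?thesis .
qed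

lemma h_eq_of_cc:
  "x \<in> carrier G \<Longrightarrow> y \<in> carrier G \<Longrightarrow> cc x = cc y \<Longrightarrow> h x = h y"
  using h_cc conj_class_refl by metis

lemma h_map_eq_of_cc:
  assumes "set xs \<subseteq> carrier G" "set ys \<subseteq> carrier G" "map cc xs = map cc ys"
  shows "map h xs = map h ys"
proof (rule nth_equalityI)
  show l: "length (map h xs) = length (map h ys)" using assms(3) by (metis length_map)
  fix i assume i: "i < length (map h xs)"
  then have "cc (xs ! i) = cc (ys ! i)" using assms(3) l by (metis length_map nth_map)
  then show "map h xs ! i = map h ys ! i"
    using i l assms h_eq_of_cc[of "xs ! i" "ys ! i"] by (auto simp: subset_iff)
qed

lemma in_T_iff:
  assumes "set xs \<subseteq> carrier G"
  shows "mset (map cc xs) \<in> carrier T \<longleftrightarrow> pr xs \<in> D"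
proof
  assume "pr xs \<in> D" then show "mset (map cc xs) \<in> carrier T"
    using assms unfolding class_tuple_monoid_def by auto
next
  assume "mset (map cc xs) \<in> carrier T"
  then obtain ys where ys: "set ys \<subseteq> carrier G" "pr ys \<in> D" "mset (map cc xs) = mset (map cc ys)"
    unfolding class_tuple_monoid_def by auto
  interpret A: comm_group A by (rule comm_group_A)
  interpret h: group_hom G A h by (rule h_hom)
  from ys(3) have "image_mset cc (mset xs) = mset (map cc ys)" by simp
  from image_mset_eq_mset[OF this]
  obtain zs where zs: "mset zs = mset xs" "map cc zs = map cc ys" by auto
  have zc: "set zs \<subseteq> carrier G" using zs(1) assms by (metis mset_eq_setD)
  have "foldr (\<otimes>\<^bsub>A\<^esub>) (map h xs) \<one>\<^bsub>A\<^esub> = foldr (\<otimes>\<^bsub>A\<^esub>) (map h zs) \<one>\<^bsub>A\<^esub>"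
    by (rule A.multlist_perm_cong) (use zs assms h.hom_closed in auto)
  also have "map h zs = map h ys" by (rule h_map_eq_of_cc[OF zc ys(1) zs(2)])
  finally have "h (pr xs) = h (pr ys)" using assms ys by (simp add: h_pr)
  then show "pr xs \<in> D" using ys assms h_one_iff multlist_closed by metis
qed

lemma comm_monoid_T: "comm_monoid T"
proof (rule comm_monoidI)
  fix M N assume "M \<in> carrier T" "N \<in> carrier T"
  then obtain xs ys where *: "set xs \<subseteq> carrier G" "pr xs \<in> D" "M = mset (map cc xs)"
    "set ys \<subseteq> carrier G" "pr ys \<in> D" "N = mset (map cc ys)"
    unfolding class_tuple_monoid_def by auto
  have app: "pr (xs @ ys) = pr xs \<otimes> pr ys" using *(1,4)
    by (induction xs) (auto simp: m_assoc)
  have "pr (xs @ ys) \<in> D"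
    unfolding app using * derived_is_subgroup[of "carrier G"] by (simp add: subgroup.m_closed)
  moreover have "M \<otimes>\<^bsub>T\<^esub> N = mset (map cc (xs @ ys))"
    using * by (simp add: class_tuple_monoid_def)
  ultimately show "M \<otimes>\<^bsub>T\<^esub> N \<in> carrier T" using * in_T_iff[of "xs @ ys"] by simp
next
  show "\<one>\<^bsub>T\<^esub> \<in> carrier T"
    using in_T_iff[of "[]"] derived_is_subgroup[of "carrier G"]
    by (simp add: subgroup.one_closed) (simp add: class_tuple_monoid_def)
qed (simp_all add: class_tuple_monoid_def)

lemma T_mult [simp]: "M \<otimes>\<^bsub>T\<^esub> N = M + N"
  and T_one [simp]: "\<one>\<^bsub>T\<^esub> = {#}"
  by (simp_all add: class_tuple_monoid_def)

lemma T_set: "M \<in> carrier T \<Longrightarrow> set_mset M \<subseteq> cc ` carrier G"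
  unfolding class_tuple_monoid_def by (auto simp: subset_iff)

lemma T_plus: "M \<in> carrier T \<Longrightarrow> N \<in> carrier T \<Longrightarrow> M + N \<in> carrier T"
  using monoid.m_closed[OF comm_monoid.axioms(1)[OF comm_monoid_T]] by simp

lemma T_cancel:
  assumes "set_mset M \<subseteq> cc ` carrier G" "N \<in> carrier T"
  shows "M + N \<in> carrier T \<longleftrightarrow> M \<in> carrier T"
proof
  assume MN: "M + N \<in> carrier T"
  obtain ws where "mset ws = M" using ex_mset by blast
  with assms(1) have "set ws \<subseteq> cc ` carrier G" by auto
  then obtain xs where xs: "set xs \<subseteq> carrier G" "ws = map cc xs"
    using ex_map_of_set_subset[of ws cc "carrier G"] by blast
  obtain ys where ys: "set ys \<subseteq> carrier G" "pr ys \<in> D" "N = mset (map cc ys)"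
    using assms(2) unfolding class_tuple_monoid_def by auto
  have M: "M = mset (map cc xs)" using xs \<open>mset ws = M\<close> by simp
  have s: "subgroup D G" using derived_is_subgroup[of "carrier G"] by simp
  have app: "pr (xs @ ys) = pr xs \<otimes> pr ys" using xs(1) ys(1)
    by (induction xs) (auto simp: m_assoc)
  have "pr (xs @ ys) \<in> D" using in_T_iff[of "xs @ ys"] xs ys MN M by simp
  then have "pr xs \<otimes> pr ys \<otimes> inv (pr ys) \<in> D"
    unfolding app using s ys by (simp add: subgroup.m_closed subgroup.m_inv_closed)
  then have "pr xs \<in> D" using xs ys by (simp add: m_assoc)
  then show "M \<in> carrier T" unfolding M using in_T_iff xs by simp
qed (use assms T_plus in auto)

lemma pair_in_T: "x \<in> carrier G \<Longrightarrow> cancelling_pair G x \<in> carrier T"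
  using in_T_iff[of "[x, inv x]"] derived_is_subgroup[of "carrier G"]
  by (simp add: cancelling_pair_def subgroup.one_closed)

lemma one_in_T: "{#cc \<one>#} \<in> carrier T"
  using in_T_iff[of "[\<one>]"] derived_is_subgroup[of "carrier G"]
  by (simp add: subgroup.one_closed)

lemma comm_monoid_submonoid_tuples: "comm_monoid_submonoid T (trivial_tuples G)"
  unfolding trivial_tuples_def
  by (intro comm_monoid_submonoid.intro comm_monoid_T submonoid_generated_submonoid
        comm_monoid.axioms(1)[OF comm_monoid_T]) (use one_in_T in auto)

interpretation L1: comm_monoid_submonoid T "trivial_tuples G" by (rule comm_monoid_submonoid_tuples)

private abbreviation (input) "L \<equiv> Lambda_monoid G"
private abbreviation (input) "lc \<equiv> Lambda_class G"

lemma comm_monoid_L: "comm_monoid L"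
  unfolding Lambda_monoid_def by (rule L1.comm_monoid_quot)

lemma L_carrier: "carrier L = lc ` carrier T"
  and L_mult: "\<And>M N. M \<in> carrier T \<Longrightarrow> N \<in> carrier T \<Longrightarrow> lc M \<otimes>\<^bsub>L\<^esub> lc N = lc (M + N)"
  and L_one: "\<one>\<^bsub>L\<^esub> = lc {#}"
  using L1.quot_carrier L1.quot_mult L1.quot_one
  by (simp_all add: Lambda_monoid_def Lambda_class_def)

lemma comm_monoid_submonoid_Lambda: "comm_monoid_submonoid L (cancelling_elements G)"
  unfolding cancelling_elements_def
  by (intro comm_monoid_submonoid.intro comm_monoid_L submonoid_generated_submonoid
        comm_monoid.axioms(1)[OF comm_monoid_L]) (use pair_in_T L_carrier in auto)

interpretation L2: comm_monoid_submonoid L "cancelling_elements G" by (rule comm_monoid_submonoid_Lambda)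

private abbreviation (input) "B \<equiv> B_group G"
private abbreviation (input) "bc \<equiv> B_class G"

lemma comm_monoid_B: "comm_monoid B"
  unfolding B_group_def by (rule L2.comm_monoid_quot)

lemma B_carrier: "carrier B = bc ` carrier T"
  and B_mult: "\<And>M N. M \<in> carrier T \<Longrightarrow> N \<in> carrier T \<Longrightarrow> bc M \<otimes>\<^bsub>B\<^esub> bc N = bc (M + N)"
  and B_one: "\<one>\<^bsub>B\<^esub> = bc {#}"
  using L2.quot_carrier L2.quot_mult L2.quot_one
  by (auto simp: B_group_def B_class_def L_carrier L_mult L_one image_image)

lemma lc_add_one: "M \<in> carrier T \<Longrightarrow> lc (add_mset (cc \<one>) M) = lc M"
proof -
  assume M: "M \<in> carrier T"
  have "{#cc \<one>#} \<in> trivial_tuples G" unfolding trivial_tuples_def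
    by (rule submonoid_generated_incl) simp
  moreover have "add_mset (cc \<one>) M \<in> carrier T" using T_plus[OF M one_in_T] by simp
  ultimately show ?thesis unfolding Lambda_class_def
    using M L1.quot_eq_iff[of "add_mset (cc \<one>) M" M] L1.one_closed
    by (metis (no_types, lifting) T_mult T_one add_mset_add_single empty_neutral(2))
qed

lemma bc_add_pair:
  assumes M: "M \<in> carrier T" and x: "x \<in> carrier G"
  shows "bc (cancelling_pair G x + M) = bc M"
proof -
  let ?p = "cancelling_pair G x"
  have p: "lc ?p \<in> cancelling_elements G" unfolding cancelling_elements_def
    by (rule submonoid_generated_incl) (use x in auto)
  have pM: "?p \<in> carrier T" "?p + M \<in> carrier T" using pair_in_T[OF x] T_plus M by simp_all
  interpret LM: comm_monoid L by (rule comm_monoid_L)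
  have "lc (?p + M) \<in> carrier L" "lc M \<in> carrier L" using pM M by (simp_all add: L_carrier)
  moreover have "lc (?p + M) \<otimes>\<^bsub>L\<^esub> \<one>\<^bsub>L\<^esub> = lc M \<otimes>\<^bsub>L\<^esub> lc ?p"
    using calculation L_mult[OF M pM(1)] by (simp add: add.commute)
  moreover have "\<one>\<^bsub>L\<^esub> \<in> cancelling_elements G" by (rule L2.one_closed)
  ultimately show ?thesis unfolding B_class_def
    using p L2.quot_eq_iff by blast
qed

lemma bc_inv:
  assumes "set_mset Q \<subseteq> cc ` carrier G"
  shows "Q + image_mset (class_inv G) Q \<in> carrier T \<and> bc (Q + image_mset (class_inv G) Q) = \<one>\<^bsub>B\<^esub>"
  using assms
proof (induction Q)
  case empty then show ?case using L1.one_closed by (simp add: B_one)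
next
  case (add c Q)
  then obtain x where x: "x \<in> carrier G" "c = cc x" by auto
  let ?P = "Q + image_mset (class_inv G) Q"
  have "add_mset c Q + image_mset (class_inv G) (add_mset c Q) = cancelling_pair G x + ?P"
    using x by (simp add: cancelling_pair_def class_inv_conj_class)
  moreover have "?P \<in> carrier T" "bc ?P = \<one>\<^bsub>B\<^esub>" using add by simp_all
  ultimately show ?case
    using bc_add_pair[of ?P x] T_plus[OF pair_in_T[of x], of ?P] x by metis
qed

lemma inv_in_T:
  assumes "M \<in> carrier T" shows "image_mset (class_inv G) M \<in> carrier T"
proof -
  have s: "set_mset M \<subseteq> cc ` carrier G" by (rule T_set[OF assms])
  then have "set_mset (image_mset (class_inv G) M) \<subseteq> cc ` carrier G"
    using class_inv_conj_class by auto
  then show ?thesis using T_cancel[of "image_mset (class_inv G) M" M] bc_inv[OF s] assms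
    by (simp add: add.commute)
qed

lemma comm_group_B_group: "comm_group B"
proof (rule group.group_comm_groupI)
  interpret B: comm_monoid B by (rule comm_monoid_B)
  show "group B"
  proof (rule groupI)
    fix x assume "x \<in> carrier B"
    then obtain M where M: "M \<in> carrier T" "x = bc M" by (auto simp: B_carrier)
    then have "bc (image_mset (class_inv G) M) \<otimes>\<^bsub>B\<^esub> x = \<one>\<^bsub>B\<^esub>"
      using inv_in_T[OF M(1)] bc_inv[OF T_set[OF M(1)]] by (simp add: B_mult add.commute)
    then show "\<exists>y\<in>carrier B. y \<otimes>\<^bsub>B\<^esub> x = \<one>\<^bsub>B\<^esub>"
      using inv_in_T[OF M(1)] by (auto simp: B_carrier)
  qed (auto simp: B.m_assoc)
  fix x y assume "x \<in> carrier B" "y \<in> carrier B"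
  then show "x \<otimes>\<^bsub>B\<^esub> y = y \<otimes>\<^bsub>B\<^esub> x" by (rule B.m_comm)
qed

lemma trivial_tuples_cc_one:
  assumes "M \<in> trivial_tuples G" shows "set_mset M \<subseteq> {cc \<one>}"
proof -
  have "submonoid {M \<in> carrier T. set_mset M \<subseteq> {cc \<one>}} T"
    by (rule submonoid.intro) (use T_plus L1.one_closed in auto)
  from submonoid_generated_least[OF this, of "{{#cc \<one>#}}"] show ?thesis
    using assms one_in_T unfolding trivial_tuples_def by auto
qed

lemma cancelling_elements_balanced:
  assumes "z \<in> cancelling_elements G"
  shows "\<exists>Q. set_mset Q \<subseteq> cc ` carrier G \<and> z = lc (Q + image_mset (class_inv G) Q)"
proof -
  let ?P = "\<lambda>Q. Q + image_mset (class_inv G) Q"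
  let ?H = "{lc (?P Q) | Q. set_mset Q \<subseteq> cc ` carrier G}"
  have "submonoid ?H L"
  proof (rule submonoid.intro)
    show "?H \<subseteq> carrier L" using bc_inv by (auto simp: L_carrier)
    show "\<one>\<^bsub>L\<^esub> \<in> ?H" by (auto simp: L_one intro!: exI[of _ "{#}"])
    fix x y assume "x \<in> ?H" "y \<in> ?H"
    then obtain Q Q' where *: "set_mset Q \<subseteq> cc ` carrier G" "x = lc (?P Q)"
      "set_mset Q' \<subseteq> cc ` carrier G" "y = lc (?P Q')" by auto
    then have "x \<otimes>\<^bsub>L\<^esub> y = lc (?P (Q + Q'))"
      using bc_inv[of Q] bc_inv[of Q'] by (simp add: L_mult ac_simps)
    then show "x \<otimes>\<^bsub>L\<^esub> y \<in> ?H" using * by (intro CollectI exI[of _ "Q + Q'"]) auto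
  qed
  moreover have "lc (cancelling_pair G x) \<in> ?H" if "x \<in> carrier G" for x
    using that by (intro CollectI exI[of _ "{#cc x#}"])
      (auto simp: cancelling_pair_def class_inv_conj_class add_mset_commute)
  ultimately have "cancelling_elements G \<subseteq> ?H"
    unfolding cancelling_elements_def by (intro submonoid_generated_least) auto
  then show ?thesis using assms by auto
qed

lemma bc_eqD:
  assumes "M \<in> carrier T" "N \<in> carrier T" "bc M = bc N"
  obtains Q Q' U U' where "set_mset Q \<subseteq> cc ` carrier G" "set_mset Q' \<subseteq> cc ` carrier G"
    "set_mset U \<subseteq> {cc \<one>}" "set_mset U' \<subseteq> {cc \<one>}"
    "M + (Q + image_mset (class_inv G) Q) + U = N + (Q' + image_mset (class_inv G) Q') + U'"
proof -
  obtain z z' where z: "z \<in> cancelling_elements G" "z' \<in> cancelling_elements G"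
    "lc M \<otimes>\<^bsub>L\<^esub> z = lc N \<otimes>\<^bsub>L\<^esub> z'"
    using assms L2.quot_eq_iff[of "lc M" "lc N"] unfolding B_class_def by (auto simp: L_carrier)
  obtain Q Q' where Q: "set_mset Q \<subseteq> cc ` carrier G" "z = lc (Q + image_mset (class_inv G) Q)"
    "set_mset Q' \<subseteq> cc ` carrier G" "z' = lc (Q' + image_mset (class_inv G) Q')"
    using cancelling_elements_balanced z by metis
  have "lc (M + (Q + image_mset (class_inv G) Q)) = lc (N + (Q' + image_mset (class_inv G) Q'))"
    using z(3) Q assms bc_inv[OF Q(1)] bc_inv[OF Q(3)] by (simp add: L_mult)
  then obtain U U' where "U \<in> trivial_tuples G" "U' \<in> trivial_tuples G"
    "M + (Q + image_mset (class_inv G) Q) + U = N + (Q' + image_mset (class_inv G) Q') + U'"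
    using assms bc_inv[OF Q(1)] bc_inv[OF Q(3)] T_plus unfolding Lambda_class_def
    by (subst (asm) L1.quot_eq_iff) auto
  then show ?thesis using that Q trivial_tuples_cc_one by metis
qed

lemma count_class_inv:
  assumes "set_mset Q \<subseteq> cc ` carrier G" "x \<in> carrier G"
  shows "count (image_mset (class_inv G) Q) (cc x) = count Q (cc (inv x))"
  using assms(1)
proof (induction Q)
  case (add c Q)
  then obtain y where y: "y \<in> carrier G" "c = cc y" by auto
  have "cc (inv y) = cc x \<longleftrightarrow> cc y = cc (inv x)"
    using conj_class_inv_cong[of "inv y" x] conj_class_inv_cong[of y "inv x"] y assms(2) by auto
  then show ?case using add y by (auto simp: class_inv_conj_class)
qed auto

lemma reduced_tuple_count:
  assumes "reduced_tuple G M" "x \<in> carrier G"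
  shows "if cc x = cc (inv x) then count M (cc x) \<le> 1
         else count M (cc x) = 0 \<or> count M (cc (inv x)) = 0"
proof (rule ccontr)
  assume a: "\<not> ?thesis"
  have "cancelling_pair G x \<subseteq># M"
    using a unfolding cancelling_pair_def by (auto simp: subseteq_mset_def split: if_splits)
  then show False using assms by (auto simp: reduced_tuple_def)
qed

lemma reduced_unique:
  assumes M: "M \<in> carrier T" "reduced_tuple G M" and N: "N \<in> carrier T" "reduced_tuple G N"
    and eq: "bc M = bc N"
  shows "M = N"
proof (rule multiset_eqI)
  fix c
  show "count M c = count N c"
  proof (cases "c \<in> cc ` carrier G \<and> c \<noteq> cc \<one>")
    case False
    then have "c \<notin># M" "c \<notin># N" using M N T_set by (auto simp: reduced_tuple_def)
    then show ?thesis by (simp add: not_in_iff)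
  next
    case True
    then obtain x where x: "x \<in> carrier G" "c = cc x" "cc x \<noteq> cc \<one>" by auto
    then have x': "cc (inv x) \<noteq> cc \<one>"
      using conj_class_inv_cong[of "inv x" \<one>] by auto
    obtain Q Q' U U' where *: "set_mset Q \<subseteq> cc ` carrier G" "set_mset Q' \<subseteq> cc ` carrier G"
      "set_mset U \<subseteq> {cc \<one>}" "set_mset U' \<subseteq> {cc \<one>}"
      "M + (Q + image_mset (class_inv G) Q) + U = N + (Q' + image_mset (class_inv G) Q') + U'"
      using bc_eqD[OF M(1) N(1) eq] by blast
    have z: "count U (cc y) = 0" "count U' (cc y) = 0" if "cc y \<noteq> cc \<one>" for y
      using *(3,4) that by (metis not_in_iff singletonD subsetD)+
    have e: "count M (cc y) + (count Q (cc y) + count Q (cc (inv y))) =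
        count N (cc y) + (count Q' (cc y) + count Q' (cc (inv y)))"
      if "cc y \<noteq> cc \<one>" "y \<in> carrier G" for y
      using arg_cong[OF *(5), of "\<lambda>M. count M (cc y)"] z[OF that(1)] that
      by (simp add: count_class_inv *(1,2))
    have e1: "count M (cc x) + (count Q (cc x) + count Q (cc (inv x))) =
        count N (cc x) + (count Q' (cc x) + count Q' (cc (inv x)))"
      using e[of x] x by simp
    have e2: "count M (cc (inv x)) + (count Q (cc x) + count Q (cc (inv x))) =
        count N (cc (inv x)) + (count Q' (cc x) + count Q' (cc (inv x)))"
      using e[of "inv x"] x x' by simp
    show ?thesis
    proof (cases "cc x = cc (inv x)")
      case True
      then have "count M (cc x) + 2 * count Q (cc x) = count N (cc x) + 2 * count Q' (cc x)"
        "count M (cc x) \<le> 1" "count N (cc x) \<le> 1"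
        using e1 reduced_tuple_count[OF M(2) x(1)] reduced_tuple_count[OF N(2) x(1)] by auto
      then show ?thesis using x by presburger
    next
      case False
      then show ?thesis using e1 e2 x
        reduced_tuple_count[OF M(2) x(1)] reduced_tuple_count[OF N(2) x(1)] by auto
    qed
  qed
qed

lemma reduced_exists:
  assumes "M \<in> carrier T"
  shows "\<exists>N. N \<in> carrier T \<and> reduced_tuple G N \<and> bc N = bc M"
  using assms
proof (induction "size M" arbitrary: M rule: less_induct)
  case less
  show ?case
  proof (cases "reduced_tuple G M")
    case True then show ?thesis using less by auto
  next
    case False
    then consider "cc \<one> \<in># M" | x where "x \<in> carrier G" "cancelling_pair G x \<subseteq># M"
      by (auto simp: reduced_tuple_def)
    then obtain N where "N \<in> carrier T" "size N < size M" "bc N = bc M"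
    proof cases
      case 1
      then obtain N where N: "M = add_mset (cc \<one>) N" by (metis multi_member_split)
      have "N \<in> carrier T"
        using T_cancel[OF _ one_in_T, of N] T_set[OF less(2)] less(2) N by simp
      then show ?thesis using that N lc_add_one by (simp add: B_class_def)
    next
      case (2 x)
      then obtain N where N: "M = cancelling_pair G x + N" by (metis subset_mset.le_iff_add)
      have "N \<in> carrier T"
        using T_cancel[OF _ pair_in_T[OF 2(1)], of N] T_set[OF less(2)] less(2) N
        by (simp add: add.commute)
      then show ?thesis using that N bc_add_pair 2 by (simp add: cancelling_pair_def)
    qed
    then show ?thesis using less(1) by metis
  qed
qed

lemma ex1_reduced_form:
  assumes "\<alpha> \<in> carrier (B_group G)"
  shows "\<exists>!M. M \<in> carrier (class_tuple_monoid G) \<and> reduced_tuple G M \<and> B_class G M = \<alpha>"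
proof -
  obtain M where "M \<in> carrier T" "\<alpha> = bc M" using assms by (auto simp: B_carrier)
  then show ?thesis using reduced_exists[of M] reduced_unique by metis
qed

end

end

end

theory Submission
  imports Defs
begin

text \<open>
  Signed multiplicities give coordinates on \<open>B(G)\<close>. Deleting a cancelling pair leaves, for every
  nontrivial class \<open>c\<close>, the multiplicity of \<open>c\<close> minus that of \<open>c\<inverse>\<close> unchanged, and if \<open>c = c\<inverse>\<close> it
  leaves the parity of the multiplicity of \<open>c\<close> unchanged. So there are finitely many homomorphisms
  to \<open>\<int>\<close> and finitely many to \<open>\<int>/2\<close> (lemmas \<open>signed_count_hom\<close>, \<open>parity_count_hom\<close>), and together they
  separate points, because they determine the reduced form (\<open>counts_eq_zero_imp_one\<close>). The joint
  kernel \<open>K\<close> of the signed counts consists of the elements whose reduced form has only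
  self-inverse entries, and it is also the set of \<open>\<alpha>\<close> with \<open>2\<alpha> = 0\<close>: a tuple \<open>M\<close> of self-inverse
  entries satisfies \<open>M \<oplus> M = M \<oplus> M\<inverse>\<close>, which is trivial in \<open>B(G)\<close>, while a homomorphism to \<open>\<int>\<close> kills
  every element of finite order.

  The rest is pure group theory (\<open>splits_onto_power_of_cyclic\<close>): let \<open>m\<close> be \<open>0\<close> or a prime, and let \<open>B\<close>
  be an abelian group with \<open>m x = 0\<close> for all \<open>x\<close>. If \<open>L\<close> is the joint
  kernel of finitely many homomorphisms from \<open>B\<close> to \<open>\<int>/m\<close>, then \<open>B\<close> maps onto some \<open>(\<int>/m)\<^sup>a\<close> with kernel
  \<open>L\<close>, and the map has a section. The homomorphisms are treated one at a time: each of them, restricted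
  to the kernel reached so far, is either zero or, once divided by a generator of its image, a
  split surjection, so that bases of subgroups of free abelian groups never have to be compared.
  With \<open>m = 0\<close> this splits \<open>\<int>\<^sup>a\<close> off \<open>B(G)\<close> with kernel \<open>K\<close>, with \<open>m = 2\<close> it identifies \<open>K\<close> with
  \<open>(\<int>/2)\<^sup>b\<close>, and the splittings compose. Any isomorphism matches \<open>K\<close>, the solutions of \<open>2\<alpha> = 0\<close>, with
  the solutions of \<open>2w = 0\<close> in \<open>\<int>\<^sup>a \<times> (\<int>/2)\<^sup>b\<close>, which form the second factor.
\<close>

section \<open>Split surjections of abelian groups\<close>

text \<open>
  The section is kept as data, since for abelian \<open>B\<close> it turns the surjection into a decomposition
  of \<open>B\<close> as \<open>H\<close> times \<open>K\<close>. The kernel \<open>K\<close> is a parameter because it is what gets split next.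
\<close>

definition splits_onto :: "('a, 'c) monoid_scheme \<Rightarrow> ('b, 'd) monoid_scheme \<Rightarrow> 'a set \<Rightarrow> bool" where
  "splits_onto B H K \<longleftrightarrow>
     (\<exists>p\<in>hom B H. \<exists>s\<in>hom H B. (\<forall>u\<in>carrier H. p (s u) = u) \<and> K = kernel B H p)"

text \<open>
  Dividing \<open>x\<close> by the lift of its image is a retraction \<open>r\<close> of \<open>B\<close> onto \<open>K\<close>, and composing
  with \<open>r\<close> extends the surjection from \<open>K\<close> onto \<open>H'\<close> to all of \<open>B\<close>.
\<close>

lemma splits_onto_trans:
  assumes "comm_group B" "group H" "group H'"
    and BH: "splits_onto B H K" and KH': "splits_onto (B\<lparr>carrier := K\<rparr>) H' L"
  shows "splits_onto B (H \<times>\<times> H') L"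
proof -
  interpret B: comm_group B by fact
  interpret H: group H by fact
  interpret H': group H' by fact
  obtain p s where p: "p \<in> hom B H" and s: "s \<in> hom H B"
    and ps: "\<And>u. u \<in> carrier H \<Longrightarrow> p (s u) = u" and K: "K = kernel B H p"
    using BH unfolding splits_onto_def by blast
  obtain q t where q: "q \<in> hom (B\<lparr>carrier := K\<rparr>) H'" and t: "t \<in> hom H' (B\<lparr>carrier := K\<rparr>)"
    and qt: "\<And>u. u \<in> carrier H' \<Longrightarrow> q (t u) = u" and L: "L = kernel (B\<lparr>carrier := K\<rparr>) H' q"
    using KH' unfolding splits_onto_def by blast
  interpret p: group_hom B H p by unfold_locales (rule p)
  interpret s: group_hom H B s by unfold_locales (rule s)
  define r where "r x = x \<otimes>\<^bsub>B\<^esub> inv\<^bsub>B\<^esub> s (p x)" for x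
  have rK: "r x \<in> K" if "x \<in> carrier B" for x
    using that by (simp add: r_def K kernel_def ps)
  have r_mult: "r (x \<otimes>\<^bsub>B\<^esub> y) = r x \<otimes>\<^bsub>B\<^esub> r y" if "x \<in> carrier B" "y \<in> carrier B" for x y
    using that by (simp add: r_def B.inv_mult B.m_ac)
  have r_id: "r x = x" if "x \<in> K" for x
    using that by (simp add: r_def K kernel_def)
  have r_s: "r (s u) = \<one>\<^bsub>B\<^esub>" if "u \<in> carrier H" for u
    using that by (simp add: r_def ps)
  have KB: "K \<subseteq> carrier B" by (auto simp: K kernel_def)
  have tK: "t v \<in> K" if "v \<in> carrier H'" for v
    using hom_in_carrier[OF t that] by simp
  have p_t: "p (t v) = \<one>\<^bsub>H\<^esub>" if "v \<in> carrier H'" for v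
    using tK[OF that] by (simp add: K kernel_def)
  have q_mult: "q (x \<otimes>\<^bsub>B\<^esub> y) = q x \<otimes>\<^bsub>H'\<^esub> q y" if "x \<in> K" "y \<in> K" for x y
    using hom_mult[OF q] that by simp
  have q_car: "q x \<in> carrier H'" if "x \<in> K" for x
    using hom_in_carrier[OF q] that by simp
  have t_mult: "t (u \<otimes>\<^bsub>H'\<^esub> v) = t u \<otimes>\<^bsub>B\<^esub> t v" if "u \<in> carrier H'" "v \<in> carrier H'" for u v
    using hom_mult[OF t] that by simp
  have tB: "t v \<in> carrier B" if "v \<in> carrier H'" for v using tK that KB by blast
  let ?p = "\<lambda>x. (p x, q (r x))" and ?s = "\<lambda>u. s (fst u) \<otimes>\<^bsub>B\<^esub> t (snd u)"
  have "?p \<in> hom B (H \<times>\<times> H')"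
    by (rule homI) (auto simp: q_car rK r_mult q_mult)
  moreover have "?s \<in> hom (H \<times>\<times> H') B"
    by (rule homI) (auto simp: tB t_mult B.m_ac)
  moreover have "?p (?s u) = u" if "u \<in> carrier (H \<times>\<times> H')" for u
    using that KB by (auto simp: p_t tB ps r_mult r_s r_id tK qt)
  moreover have "L = kernel B (H \<times>\<times> H') ?p"
  proof -
    have "x \<in> K \<and> q x = \<one>\<^bsub>H'\<^esub> \<longleftrightarrow> x \<in> carrier B \<and> p x = \<one>\<^bsub>H\<^esub> \<and> q (r x) = \<one>\<^bsub>H'\<^esub>" for x
    proof (cases "x \<in> K")
      case True
      with r_id[OF True] show ?thesis by (simp add: K kernel_def)
    next
      case False
      then show ?thesis by (auto simp: K kernel_def)
    qed
    then show ?thesis unfolding L kernel_def by simp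
  qed
  ultimately show ?thesis unfolding splits_onto_def
    by (intro bexI[of _ ?p] bexI[of _ ?s] conjI ballI)
qed

lemma splits_onto_iso:
  assumes BH: "splits_onto B H K" and "i \<in> iso H H'" "group H" "group H'"
  shows "splits_onto B H' K"
proof -
  obtain p s where p: "p \<in> hom B H" and s: "s \<in> hom H B"
    and ps: "\<And>u. u \<in> carrier H \<Longrightarrow> p (s u) = u" and K: "K = kernel B H p"
    using BH unfolding splits_onto_def by blast
  interpret i: group_hom H H' i
    using assms by (simp add: group_hom_def group_hom_axioms_def iso_def)
  let ?j = "inv_into (carrier H) i"
  have j: "?j \<in> iso H' H" using group.iso_set_sym[OF assms(3,2)] .
  have bij: "bij_betw i (carrier H) (carrier H')" using assms(2) by (simp add: iso_def)
  have "i \<circ> p \<in> hom B H'" using p by (rule hom_compose) (rule i.homh)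
  moreover have "s \<circ> ?j \<in> hom H' B" using j s by (auto simp: iso_def intro: hom_compose)
  moreover have "(i \<circ> p) ((s \<circ> ?j) u) = u" if "u \<in> carrier H'" for u
    using that bij hom_in_carrier[of ?j H' H] j
    by (auto simp: ps iso_def bij_betw_inv_into_right)
  moreover have "K = kernel B H' (i \<circ> p)"
  proof -
    have "i (p x) = \<one>\<^bsub>H'\<^esub> \<longleftrightarrow> p x = \<one>\<^bsub>H\<^esub>" if "x \<in> carrier B" for x
      using inj_on_eq_iff[OF bij_betw_imp_inj_on[OF bij], of "p x" "\<one>\<^bsub>H\<^esub>"] hom_in_carrier[OF p that]
      by simp
    then show ?thesis unfolding K kernel_def by auto
  qed
  ultimately show ?thesis unfolding splits_onto_def
    by (intro bexI[of _ "i \<circ> p"] bexI[of _ "s \<circ> ?j"] conjI ballI)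
qed

section \<open>Groups separated by homomorphisms to a cyclic group\<close>

lemma product_group_lessThan_Suc:
  fixes a :: nat
  shows "(\<lambda>(u, v). u(a := v))
         \<in> iso (product_group {..<a} H \<times>\<times> H a) (product_group {..<Suc a} H)"
proof (rule isoI)
  show "(\<lambda>(u, v). u(a := v)) \<in> hom (product_group {..<a} H \<times>\<times> H a) (product_group {..<Suc a} H)"
  proof (rule homI; clarify)
    fix u v assume "(u, v) \<in> carrier (product_group {..<a} H \<times>\<times> H a)"
    then show "u(a := v) \<in> carrier (product_group {..<Suc a} H)"
      unfolding carrier_product_group lessThan_Suc PiE_insert_eq by (simp add: image_iff) blast
  next
    fix u v u' v'
    show "(case (u, v) \<otimes>\<^bsub>product_group {..<a} H \<times>\<times> H a\<^esub> (u', v') of (u, v) \<Rightarrow> u(a := v)) =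
       u(a := v) \<otimes>\<^bsub>product_group {..<Suc a} H\<^esub> u'(a := v')"
      unfolding mult_DirProd mult_product_group prod.case
      by (rule ext) (simp add: restrict_def)
  qed
  show "bij_betw (\<lambda>(u, v). u(a := v)) (carrier (product_group {..<a} H \<times>\<times> H a))
      (carrier (product_group {..<Suc a} H))"
  proof (rule bij_betw_imageI)
    show "inj_on (\<lambda>(u, v). u(a := v)) (carrier (product_group {..<a} H \<times>\<times> H a))"
    proof (rule inj_onI; clarify)
      fix u v u' v' assume "(u, v) \<in> carrier (product_group {..<a} H \<times>\<times> H a)"
        "(u', v') \<in> carrier (product_group {..<a} H \<times>\<times> H a)" and eq: "u(a := v) = u'(a := v')"
      \<comment> \<open>members of the product are undefined outside the index set, so the new entry overwrites nothing\<close>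
      then have "u a = undefined" "u' a = undefined" by (auto simp: PiE_iff extensional_def)
      then show "u = u' \<and> v = v'" using eq by (metis fun_upd_eqD fun_upd_triv fun_upd_upd)
    qed
    show "(\<lambda>(u, v). u(a := v)) ` carrier (product_group {..<a} H \<times>\<times> H a) =
        carrier (product_group {..<Suc a} H)"
      unfolding carrier_product_group lessThan_Suc PiE_insert_eq carrier_DirProd by force
  qed
qed

text \<open>
  The section is \<open>k \<mapsto> e\<^sup>k\<close>, which is well defined modulo \<open>m\<close> since \<open>e\<^sup>m = 1\<close>. The case \<open>m = 0\<close> is that
  of an infinite cyclic quotient.
\<close>

lemma splits_onto_cyclic:
  assumes "comm_group B" and f: "f \<in> hom B (integer_mod_group m)"
    and e: "e \<in> carrier B" "e [^]\<^bsub>B\<^esub> m = \<one>\<^bsub>B\<^esub>" "m \<noteq> 1" "f e = 1"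
  shows "splits_onto B (integer_mod_group m) (kernel B (integer_mod_group m) f)"
proof -
  interpret B: comm_group B by fact
  let ?Z = "integer_mod_group m"
  interpret f: group_hom B ?Z f
    by (intro group_hom.intro group_hom_axioms.intro B.is_group f) simp
  have em: "e [^]\<^bsub>B\<^esub> (k mod int m) = e [^]\<^bsub>B\<^esub> k" for k :: int
  proof -
    have "e [^]\<^bsub>B\<^esub> k = e [^]\<^bsub>B\<^esub> (int m * (k div int m) + k mod int m)" by simp
    also have "\<dots> = (e [^]\<^bsub>B\<^esub> int m) [^]\<^bsub>B\<^esub> (k div int m) \<otimes>\<^bsub>B\<^esub> e [^]\<^bsub>B\<^esub> (k mod int m)"
      using e(1) by (simp only: B.int_pow_mult B.int_pow_pow)
    also have "\<dots> = e [^]\<^bsub>B\<^esub> (k mod int m)" using e(1,2) by (simp add: int_pow_int B.int_pow_one)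
    finally show ?thesis by simp
  qed
  have "(\<lambda>k. e [^]\<^bsub>B\<^esub> k) \<in> hom ?Z B"
    by (rule homI) (simp_all add: e em B.int_pow_mult)
  moreover have "f (e [^]\<^bsub>B\<^esub> k) = k" if "k \<in> carrier ?Z" for k :: int
  proof -
    have "f (e [^]\<^bsub>B\<^esub> k) = k mod int m"
      using f.hom_int_pow[OF e(1), of k] e(4) by (simp add: int_pow_integer_mod_group)
    then show ?thesis using that by (cases "m = 0") (auto simp: carrier_integer_mod_group)
  qed
  ultimately show ?thesis unfolding splits_onto_def using f by blast
qed

text \<open>
  The least positive value \<open>d\<close> of \<open>f\<close> divides all values, since remainders modulo \<open>d\<close> are
  values again.
\<close>

lemma integer_hom_generator:
  assumes "group B" and f: "f \<in> hom B integer_group" and nt: "x \<in> carrier B" "f x \<noteq> 0"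
  obtains e d where "e \<in> carrier B" "f e = int d" "d > 0" "\<And>y. y \<in> carrier B \<Longrightarrow> int d dvd f y"
proof -
  interpret B: group B by fact
  interpret f: group_hom B integer_group f
    by (intro group_hom.intro group_hom_axioms.intro B.is_group f) simp
  let ?P = "\<lambda>d. d > 0 \<and> (\<exists>e\<in>carrier B. f e = int d)"
  have "\<exists>d. ?P d"
  proof (cases "f x > 0")
    case True then show ?thesis using nt by (intro exI[of _ "nat (f x)"]) auto
  next
    case False
    then show ?thesis using nt f.hom_inv[OF nt(1)] B.inv_closed[OF nt(1)]
      by (intro exI[of _ "nat (- f x)"]) (auto intro!: bexI[of _ "inv\<^bsub>B\<^esub> x"])
  qed
  then have P: "?P (LEAST d. ?P d)" by (rule LeastI_ex)
  define d where "d = (LEAST d. ?P d)"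
  obtain e where e: "d > 0" "e \<in> carrier B" "f e = int d" using P by (auto simp: d_def)
  have "int d dvd f y" if y: "y \<in> carrier B" for y
  proof (rule ccontr)
    assume nd: "\<not> int d dvd f y"
    let ?y = "y \<otimes>\<^bsub>B\<^esub> e [^]\<^bsub>B\<^esub> (- (f y div int d))"
    have "f ?y = f y - f y div int d * int d"
      using y e f.hom_int_pow[OF e(2)] by simp
    also have "\<dots> = f y mod int d" by (simp add: minus_div_mult_eq_mod)
    finally have fy: "f ?y = f y mod int d" .
    have "f y mod int d > 0" "f y mod int d < int d"
      using nd e(1) pos_mod_sign[of "int d" "f y"] pos_mod_bound[of "int d" "f y"]
        mod_eq_0_iff_dvd[of "f y" "int d"] by linarith+
    moreover have "?y \<in> carrier B" using y e by simp
    ultimately have "?P (nat (f y mod int d))" using fy by (auto intro!: bexI[of _ ?y])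
    then have "d \<le> nat (f y mod int d)" unfolding d_def by (rule Least_le)
    then show False using \<open>f y mod int d < int d\<close> e(1) by linarith
  qed
  with that e show ?thesis by blast
qed

text \<open>
  A nonzero homomorphism becomes surjective without a change of kernel: for \<open>m = 0\<close> it is divided
  by the generator of its image, and for prime \<open>m\<close> it is already surjective, as every nonzero
  value is a unit modulo \<open>m\<close>. For composite \<open>m\<close> the image may be a
  proper subgroup that is not isomorphic to \<open>\<int>/m\<close>.
\<close>

lemma splits_onto_image_of_hom:
  assumes "comm_group B" and m: "m = 0 \<or> Factorial_Ring.prime m"
    and exp: "\<And>x. x \<in> carrier B \<Longrightarrow> x [^]\<^bsub>B\<^esub> m = \<one>\<^bsub>B\<^esub>"
    and f: "f \<in> hom B (integer_mod_group m)" and x: "x \<in> carrier B" "f x \<noteq> 0"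
  shows "splits_onto B (integer_mod_group m) (kernel B (integer_mod_group m) f)"
proof -
  interpret B: comm_group B by fact
  let ?Z = "integer_mod_group m"
  interpret f: group_hom B ?Z f
    by (intro group_hom.intro group_hom_axioms.intro B.is_group f) simp
  from m have m1: "m \<noteq> 1" by auto
  show ?thesis
  proof (cases "m = 0")
    case True
    then have Z: "?Z = integer_group" by (simp add: integer_mod_group_def)
    obtain e d where e: "e \<in> carrier B" "f e = int d" "d > 0" "\<And>y. y \<in> carrier B \<Longrightarrow> int d dvd f y"
      using integer_hom_generator[of B f x] f x B.is_group unfolding Z by blast
    let ?g = "\<lambda>y. f y div int d"
    have g: "?g \<in> hom B ?Z"
    proof (rule homI)
      fix y z assume yz: "y \<in> carrier B" "z \<in> carrier B"
      then have "f (y \<otimes>\<^bsub>B\<^esub> z) = f y + f z" using f.hom_mult[OF yz] by (simp add: True)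
      then show "?g (y \<otimes>\<^bsub>B\<^esub> z) = ?g y \<otimes>\<^bsub>?Z\<^esub> ?g z"
        using e(4)[OF yz(1)] e(4)[OF yz(2)] by (simp add: True div_add)
    qed (simp add: Z)
    have "splits_onto B ?Z (kernel B ?Z ?g)"
      by (rule splits_onto_cyclic[OF assms(1) g e(1) exp[OF e(1)] m1]) (use e in simp)
    also have "kernel B ?Z ?g = kernel B ?Z f"
      using e(3,4) by (auto simp: kernel_def dvd_div_eq_0_iff)
    finally show ?thesis .
  next
    case False
    then have p: "Factorial_Ring.prime (int m)" using m by simp
    have "f x \<in> carrier ?Z" using x by simp
    then have "\<not> int m dvd f x" using x False zdvd_not_zless[of "f x" "int m"]
      by (auto simp: carrier_integer_mod_group)
    then have "coprime (f x) (int m)" using p by (simp add: prime_imp_coprime coprime_commute)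
    then obtain k j where kj: "k * f x + j * int m = 1"
      using bezout_int[of "f x" "int m"] by auto
    have "(k * f x) mod int m = (k * f x + j * int m) mod int m" by simp
    also have "\<dots> = 1" unfolding kj using m1 False by simp
    finally have k: "(k * f x) mod int m = 1" .
    let ?e = "x [^]\<^bsub>B\<^esub> k"
    have "f ?e = 1" using f.hom_int_pow[OF x(1), of k] k by (simp add: int_pow_integer_mod_group)
    then show ?thesis using splits_onto_cyclic[OF assms(1) f _ _ m1, of ?e] x exp by simp
  qed
qed

text \<open>
  Induction on \<open>F\<close>: a further homomorphism matters only through its restriction to the joint kernel
  of the earlier ones. If that restriction is zero, the exponent \<open>a\<close> stays, and otherwise it
  splits off one more cyclic factor.
\<close>

lemma splits_onto_power_of_cyclic:
  assumes "comm_group B" and m: "m = 0 \<or> Factorial_Ring.prime m"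
    and exp: "\<And>x. x \<in> carrier B \<Longrightarrow> x [^]\<^bsub>B\<^esub> m = \<one>\<^bsub>B\<^esub>"
    and "finite F" "F \<subseteq> hom B (integer_mod_group m)"
  shows "\<exists>a::nat. splits_onto B (product_group {..<a} (\<lambda>_. integer_mod_group m))
           {x \<in> carrier B. \<forall>f\<in>F. f x = 0}"
  using assms(4,5)
proof (induction F rule: finite_induct)
  case empty
  interpret B: comm_group B by fact
  have "splits_onto B (product_group {..<0::nat} (\<lambda>_. integer_mod_group m)) (carrier B)"
    unfolding splits_onto_def
    by (rule bexI[of _ "\<lambda>_ _. undefined"], rule bexI[of _ "\<lambda>_. \<one>\<^bsub>B\<^esub>"])
      (auto simp: hom_def kernel_def)
  then show ?case by (auto intro: exI[of _ "0::nat"])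
next
  case (insert f F)
  interpret B: comm_group B by fact
  let ?Z = "integer_mod_group m" and ?K = "{x \<in> carrier B. \<forall>f\<in>F. f x = 0}"
  let ?P = "\<lambda>a::nat. product_group {..<a} (\<lambda>_. ?Z)"
  have f: "f \<in> hom B ?Z" using insert by simp
  obtain a :: nat where a: "splits_onto B (?P a) ?K" using insert by auto
  show ?case
  proof (cases "\<forall>x\<in>?K. f x = 0")
    case True
    then have "{x \<in> carrier B. \<forall>f\<in>insert f F. f x = 0} = ?K" by auto
    then show ?thesis using a by metis
  next
    case False
    then obtain x where x: "x \<in> ?K" "f x \<noteq> 0" by blast
    let ?B = "B\<lparr>carrier := ?K\<rparr>"
    have "subgroup ?K B"
    proof -
      obtain p where "p \<in> hom B (?P a)" "?K = kernel B (?P a) p"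
        using a unfolding splits_onto_def by blast
      moreover from this interpret p: group_hom B "?P a" p
        by (intro group_hom.intro group_hom_axioms.intro B.is_group) simp_all
      show ?thesis using p.subgroup_kernel calculation by simp
    qed
    then have "group ?B" by (rule B.subgroup_imp_group)
    then have cB: "comm_group ?B" by (rule group.group_comm_groupI) (simp add: B.m_comm)
    have "splits_onto ?B ?Z (kernel ?B ?Z f)"
    proof (rule splits_onto_image_of_hom[OF cB m])
      show "y [^]\<^bsub>?B\<^esub> m = \<one>\<^bsub>?B\<^esub>" if "y \<in> carrier ?B" for y
        using that exp by (simp add: nat_pow_def)
      show "f \<in> hom ?B ?Z" using f by (auto simp: hom_def)
    qed (use x in simp_all)
    then have "splits_onto B (?P a \<times>\<times> ?Z) (kernel ?B ?Z f)"
      by (intro splits_onto_trans[OF assms(1) _ _ a]) simp_all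
    then have "splits_onto B (?P (Suc a)) (kernel ?B ?Z f)"
      by (rule splits_onto_iso[OF _ product_group_lessThan_Suc]) (simp_all add: DirProd_group)
    moreover have "kernel ?B ?Z f = {x \<in> carrier B. \<forall>f\<in>insert f F. f x = 0}"
      by (auto simp: kernel_def)
    ultimately show ?thesis by metis
  qed
qed

section \<open>Isomorphisms and elements of order two\<close>

lemma splits_onto_trivial_kernel_iso:
  assumes "group B" "group H" "splits_onto B H K" "K = {\<one>\<^bsub>B\<^esub>}"
  shows "B \<cong> H"
proof -
  obtain p s where p: "p \<in> hom B H" and s: "s \<in> hom H B"
    and ps: "\<And>u. u \<in> carrier H \<Longrightarrow> p (s u) = u" and K: "K = kernel B H p"
    using assms(3) unfolding splits_onto_def by blast
  interpret group_hom B H p using assms p by (simp add: group_hom_def group_hom_axioms_def)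
  have "carrier H \<subseteq> p ` carrier B" using ps hom_in_carrier[OF s] by force
  moreover have "p ` carrier B \<subseteq> carrier H" using hom_in_carrier[OF p] by blast
  moreover have "inj_on p (carrier B)" using K assms(4) inj_iff_trivial_ker by simp
  ultimately have "p \<in> iso B H" using p by (simp add: iso_def bij_betw_def)
  then show ?thesis by (auto simp: is_iso_def)
qed

lemma iso_image_involutions:
  assumes "group B" "group H" "\<phi> \<in> iso B H"
  shows "\<phi> ` {x \<in> carrier B. x \<otimes>\<^bsub>B\<^esub> x = \<one>\<^bsub>B\<^esub>} = {w \<in> carrier H. w \<otimes>\<^bsub>H\<^esub> w = \<one>\<^bsub>H\<^esub>}"
proof -
  interpret B: group B by fact
  have bij: "bij_betw \<phi> (carrier B) (carrier H)" and hom: "\<phi> \<in> hom B H"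
    using assms(3) by (simp_all add: iso_def)
  have "\<phi> x \<otimes>\<^bsub>H\<^esub> \<phi> x = \<one>\<^bsub>H\<^esub> \<longleftrightarrow> x \<otimes>\<^bsub>B\<^esub> x = \<one>\<^bsub>B\<^esub>" if x: "x \<in> carrier B" for x
    using inj_on_eq_iff[OF bij_betw_imp_inj_on[OF bij], of "x \<otimes>\<^bsub>B\<^esub> x" "\<one>\<^bsub>B\<^esub>"]
      hom_mult[OF hom x x] hom_one[OF hom assms(1,2)] x by simp
  then show ?thesis unfolding bij_betw_imp_surj_on[OF bij, symmetric] by auto
qed

section \<open>Multiplicities in reduced forms\<close>

context group
begin

lemma conj_class_eq_inv_iff:
  assumes "x \<in> carrier G"
  shows "inv x \<in> conj_class G x \<longleftrightarrow> conj_class G x = conj_class G (inv x)"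
proof
  interpret conj: group_action G "carrier G" "\<lambda>g. \<lambda>h\<in>carrier G. g \<otimes> h \<otimes> inv g"
    by (rule action_by_conjugation)
  assume i: "inv x \<in> conj_class G x"
  have sub: "conj_class G y \<subseteq> conj_class G z"
    if "y \<in> carrier G" "z \<in> carrier G" "y \<in> conj_class G z" for y z
  proof
    fix w assume w: "w \<in> conj_class G y"
    then have "w \<in> carrier G" using that by (auto simp: conj_class_eq)
    then show "w \<in> conj_class G z"
      using w that conj.orbit_trans[of z y w] unfolding conj_class_def by simp
  qed
  have "x \<in> conj_class G (inv x)"
    using i assms conj.orbit_sym[of x "inv x"] unfolding conj_class_def by simp
  with i assms show "conj_class G x = conj_class G (inv x)"
    by (intro equalityI sub) simp_all
next
  assume "conj_class G x = conj_class G (inv x)"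
  then show "inv x \<in> conj_class G x" using assms conj_class_refl[of "inv x"] by simp
qed

text \<open>
  Tuples with the same class differ by trivial entries and by entries that come in pairs
  \<open>c, c\<inverse>\<close>. Such pairs contribute equally to \<open>c\<close> and \<open>c\<inverse>\<close>, and evenly if the two coincide. The trivial
  class must be excluded for the parity, since it may be added any number of times.
\<close>

lemma B_class_eq_count:
  assumes M: "M \<in> carrier (class_tuple_monoid G)" and N: "N \<in> carrier (class_tuple_monoid G)"
    and eq: "B_class G M = B_class G N"
    and x: "x \<in> carrier G" "conj_class G x \<noteq> conj_class G \<one>"
  shows "int (count M (conj_class G x)) - int (count M (conj_class G (inv x))) =
         int (count N (conj_class G x)) - int (count N (conj_class G (inv x)))"
    and "conj_class G x = conj_class G (inv x) \<Longrightarrow>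
         count M (conj_class G x) mod 2 = count N (conj_class G x) mod 2"
proof -
  let ?cc = "conj_class G"
  have x': "?cc (inv x) \<noteq> ?cc \<one>"
    using conj_class_inv_cong[of "inv x" \<one>] x by auto
  obtain Q Q' U U' where *: "set_mset Q \<subseteq> ?cc ` carrier G" "set_mset Q' \<subseteq> ?cc ` carrier G"
    "set_mset U \<subseteq> {?cc \<one>}" "set_mset U' \<subseteq> {?cc \<one>}"
    "M + (Q + image_mset (class_inv G) Q) + U = N + (Q' + image_mset (class_inv G) Q') + U'"
    using bc_eqD[OF M N eq] by blast
  have z: "count U (?cc y) = 0" "count U' (?cc y) = 0" if "?cc y \<noteq> ?cc \<one>" for y
    using *(3,4) that by (metis not_in_iff singletonD subsetD)+
  have e: "count M (?cc y) + (count Q (?cc y) + count Q (?cc (inv y))) =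
      count N (?cc y) + (count Q' (?cc y) + count Q' (?cc (inv y)))"
    if "?cc y \<noteq> ?cc \<one>" "y \<in> carrier G" for y
    using arg_cong[OF *(5), of "\<lambda>M. count M (?cc y)"] z[OF that(1)] that
    by (simp add: count_class_inv *(1,2))
  show "int (count M (?cc x)) - int (count M (?cc (inv x))) =
      int (count N (?cc x)) - int (count N (?cc (inv x)))"
    using e[of x] e[of "inv x"] x x' by simp
  assume s: "?cc x = ?cc (inv x)"
  have "count M (?cc x) + 2 * count Q (?cc x) = count N (?cc x) + 2 * count Q' (?cc x)"
    using e[OF x(2,1)] s by simp
  then show "count M (?cc x) mod 2 = count N (?cc x) mod 2" by presburger
qed

lemma reduced_form:
  assumes "\<alpha> \<in> carrier (B_group G)"
  shows "reduced_form G \<alpha> \<in> carrier (class_tuple_monoid G)"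
    and "reduced_tuple G (reduced_form G \<alpha>)"
    and "B_class G (reduced_form G \<alpha>) = \<alpha>"
  using theI'[OF ex1_reduced_form[OF assms]] unfolding reduced_form_def by blast+

text \<open>
  Reduced forms are not additive, as cancelling pairs may arise in the sum, but everything that
  depends only on the class of a tuple can be computed from the unreduced sum.
\<close>

lemma reduced_form_mult:
  assumes "\<alpha> \<in> carrier (B_group G)" "\<beta> \<in> carrier (B_group G)"
  shows "reduced_form G (\<alpha> \<otimes>\<^bsub>B_group G\<^esub> \<beta>) \<in> carrier (class_tuple_monoid G)"
    and "reduced_form G \<alpha> + reduced_form G \<beta> \<in> carrier (class_tuple_monoid G)"
    and "B_class G (reduced_form G (\<alpha> \<otimes>\<^bsub>B_group G\<^esub> \<beta>)) = B_class G (reduced_form G \<alpha> + reduced_form G \<beta>)"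
proof -
  interpret B: comm_group "B_group G" by (rule comm_group_B_group)
  have c: "\<alpha> \<otimes>\<^bsub>B_group G\<^esub> \<beta> \<in> carrier (B_group G)" using assms by simp
  show "reduced_form G (\<alpha> \<otimes>\<^bsub>B_group G\<^esub> \<beta>) \<in> carrier (class_tuple_monoid G)"
    by (rule reduced_form[OF c])
  show "reduced_form G \<alpha> + reduced_form G \<beta> \<in> carrier (class_tuple_monoid G)"
    by (intro T_plus reduced_form assms)
  show "B_class G (reduced_form G (\<alpha> \<otimes>\<^bsub>B_group G\<^esub> \<beta>)) = B_class G (reduced_form G \<alpha> + reduced_form G \<beta>)"
    using B_mult[of "reduced_form G \<alpha>" "reduced_form G \<beta>"] assms reduced_form(3)[OF c] by (simp add: reduced_form)
qed

definition signed_count :: "'a \<Rightarrow> 'a set multiset set set \<Rightarrow> int" where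
  "signed_count x \<alpha> = int (count (reduced_form G \<alpha>) (conj_class G x)) -
                      int (count (reduced_form G \<alpha>) (conj_class G (inv x)))"

text \<open>
  The value is zero where the parity is not an invariant, so that every \<open>x\<close> in \<open>G\<close> may serve as an
  index.
\<close>

definition parity_count :: "'a \<Rightarrow> 'a set multiset set set \<Rightarrow> int" where
  "parity_count x \<alpha> =
     (if conj_class G x = conj_class G (inv x) \<and> conj_class G x \<noteq> conj_class G \<one>
      then int (count (reduced_form G \<alpha>) (conj_class G x)) mod 2 else 0)"

lemma signed_count_hom:
  assumes "x \<in> carrier G" shows "signed_count x \<in> hom (B_group G) integer_group"
proof (rule homI)
  fix \<alpha> \<beta> assume ab: "\<alpha> \<in> carrier (B_group G)" "\<beta> \<in> carrier (B_group G)"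
  show "signed_count x (\<alpha> \<otimes>\<^bsub>B_group G\<^esub> \<beta>) = signed_count x \<alpha> \<otimes>\<^bsub>integer_group\<^esub> signed_count x \<beta>"
  proof (cases "conj_class G x = conj_class G \<one>")
    case True
    then have "conj_class G (inv x) = conj_class G x"
      using conj_class_inv_cong[of x \<one>] assms by simp
    then show ?thesis by (simp add: signed_count_def)
  next
    case False
    then show ?thesis
      using B_class_eq_count(1)[OF reduced_form_mult[OF ab] assms] by (simp add: signed_count_def)
  qed
qed simp

lemma parity_count_hom:
  assumes "x \<in> carrier G" shows "parity_count x \<in> hom (B_group G) (integer_mod_group 2)"
proof (rule homI)
  fix \<alpha> \<beta> assume ab: "\<alpha> \<in> carrier (B_group G)" "\<beta> \<in> carrier (B_group G)"
  show "parity_count x (\<alpha> \<otimes>\<^bsub>B_group G\<^esub> \<beta>) =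
      parity_count x \<alpha> \<otimes>\<^bsub>integer_mod_group 2\<^esub> parity_count x \<beta>"
  proof (cases "conj_class G x = conj_class G (inv x) \<and> conj_class G x \<noteq> conj_class G \<one>")
    case True
    let ?n = "\<lambda>\<alpha>. count (reduced_form G \<alpha>) (conj_class G x)"
    have "?n (\<alpha> \<otimes>\<^bsub>B_group G\<^esub> \<beta>) mod 2 = (?n \<alpha> + ?n \<beta>) mod 2"
      using B_class_eq_count(2)[OF reduced_form_mult[OF ab] assms conjunct2[OF True] conjunct1[OF True]]
      unfolding count_union .
    then have "int (?n (\<alpha> \<otimes>\<^bsub>B_group G\<^esub> \<beta>)) mod 2 = (int (?n \<alpha>) mod 2 + int (?n \<beta>) mod 2) mod 2"
      by presburger
    then show ?thesis unfolding parity_count_def if_P[OF True] by simp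
  next
    case False
    show ?thesis unfolding parity_count_def if_not_P[OF False] by simp
  qed
qed (simp add: parity_count_def carrier_integer_mod_group)

text \<open>
  A reduced tuple does not contain both \<open>c\<close> and \<open>c\<inverse>\<close> if they differ, so equal multiplicities of the
  two are zero.
\<close>

lemma self_inverse_iff_signed_count:
  assumes a: "\<alpha> \<in> carrier (B_group G)"
  shows "self_inverse_tuple G (reduced_form G \<alpha>) \<longleftrightarrow> (\<forall>x\<in>carrier G. signed_count x \<alpha> = 0)"
proof
  assume s: "self_inverse_tuple G (reduced_form G \<alpha>)"
  show "\<forall>x\<in>carrier G. signed_count x \<alpha> = 0"
  proof
    fix x assume x: "x \<in> carrier G"
    then have "conj_class G y = conj_class G (inv y)"
      if "y \<in> {x, inv x}" "conj_class G y \<in># reduced_form G \<alpha>" for y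
      using s that conj_class_eq_inv_iff[of y] unfolding self_inverse_tuple_def by auto
    from this[of x] this[of "inv x"] x show "signed_count x \<alpha> = 0"
      unfolding signed_count_def by (metis diff_self insertCI inv_inv not_in_iff)
  qed
next
  assume z: "\<forall>x\<in>carrier G. signed_count x \<alpha> = 0"
  show "self_inverse_tuple G (reduced_form G \<alpha>)" unfolding self_inverse_tuple_def
  proof (intro ballI impI)
    fix x assume x: "x \<in> carrier G" "conj_class G x \<in># reduced_form G \<alpha>"
    let ?n = "\<lambda>y. count (reduced_form G \<alpha>) (conj_class G y)"
    have "?n x = ?n (inv x)" using bspec[OF z x(1)] by (simp add: signed_count_def)
    moreover have "?n x \<noteq> 0" using x(2) by simp
    ultimately have "conj_class G x = conj_class G (inv x)"
      using reduced_tuple_count[OF reduced_form(2)[OF a] x(1)] by presburger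
    then show "inv x \<in> conj_class G x" using conj_class_eq_inv_iff[OF x(1)] by simp
  qed
qed

text \<open>
  For self-inverse entries, doubling a tuple is the same as adding its inverse. Conversely, signed
  counts take values in a torsion-free group.
\<close>

lemma self_inverse_iff_involution:
  assumes a: "\<alpha> \<in> carrier (B_group G)"
  shows "self_inverse_tuple G (reduced_form G \<alpha>) \<longleftrightarrow> \<alpha> \<otimes>\<^bsub>B_group G\<^esub> \<alpha> = \<one>\<^bsub>B_group G\<^esub>"
proof
  let ?M = "reduced_form G \<alpha>"
  assume s: "self_inverse_tuple G ?M"
  have set: "set_mset ?M \<subseteq> conj_class G ` carrier G" by (rule T_set[OF reduced_form(1)[OF a]])
  have "class_inv G c = c" if c: "c \<in># ?M" for c
  proof -
    obtain x where x: "x \<in> carrier G" "c = conj_class G x"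
      using imageE[OF subsetD[OF set c]] by metis
    have "inv x \<in> conj_class G x" using s c x unfolding self_inverse_tuple_def by simp
    then show ?thesis using class_inv_conj_class[OF x(1)] conj_class_eq_inv_iff[OF x(1)] x(2) by simp
  qed
  then have "image_mset (class_inv G) ?M = image_mset (\<lambda>c. c) ?M" by (intro image_mset_cong) auto
  then have "B_class G (?M + ?M) = \<one>\<^bsub>B_group G\<^esub>" using bc_inv[OF set] by simp
  then show "\<alpha> \<otimes>\<^bsub>B_group G\<^esub> \<alpha> = \<one>\<^bsub>B_group G\<^esub>"
    using B_mult[OF reduced_form(1)[OF a] reduced_form(1)[OF a]] reduced_form(3)[OF a] by simp
next
  interpret B: comm_group "B_group G" by (rule comm_group_B_group)
  assume sq: "\<alpha> \<otimes>\<^bsub>B_group G\<^esub> \<alpha> = \<one>\<^bsub>B_group G\<^esub>"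
  have "signed_count x \<alpha> = 0" if "x \<in> carrier G" for x
    using hom_mult[OF signed_count_hom[OF that] a a] sq
      hom_one[OF signed_count_hom[OF that] B.is_group] by simp
  then show "self_inverse_tuple G (reduced_form G \<alpha>)"
    using self_inverse_iff_signed_count[OF a] by blast
qed

text \<open>
  Vanishing signed counts make all entries of the reduced form self-inverse, and such an entry
  occurs at most once, so even multiplicities leave the empty tuple.
\<close>

lemma counts_eq_zero_imp_one:
  assumes a: "\<alpha> \<in> carrier (B_group G)"
    and s: "\<And>x. x \<in> carrier G \<Longrightarrow> signed_count x \<alpha> = 0"
    and p: "\<And>x. x \<in> carrier G \<Longrightarrow> parity_count x \<alpha> = 0"
  shows "\<alpha> = \<one>\<^bsub>B_group G\<^esub>"
proof -
  let ?M = "reduced_form G \<alpha>"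
  note r = reduced_form[OF a]
  have "c \<notin># ?M" for c
  proof
    assume c: "c \<in># ?M"
    obtain x where x: "x \<in> carrier G" "c = conj_class G x"
      using imageE[OF subsetD[OF T_set[OF r(1)] c]] by metis
    have "self_inverse_tuple G ?M" using self_inverse_iff_signed_count[OF a] s by blast
    then have "inv x \<in> conj_class G x" using x c unfolding self_inverse_tuple_def by simp
    then have i: "conj_class G x = conj_class G (inv x)" using conj_class_eq_inv_iff[OF x(1)] by simp
    moreover have "conj_class G x \<noteq> conj_class G \<one>"
      using r(2) x c unfolding reduced_tuple_def by auto
    ultimately have "int (count ?M c) mod 2 = 0" using p[OF x(1)] x by (simp add: parity_count_def)
    moreover have "count ?M c \<le> 1"
      using reduced_tuple_count[OF r(2) x(1)] i x by simp
    moreover have "count ?M c > 0" using c by simp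
    ultimately show False by presburger
  qed
  then have "?M = {#}" by (metis multiset_nonemptyE)
  then show ?thesis using r(3) B_one by simp
qed

end

section \<open>The structure of the group\<close>

theorem corollary7:
  fixes G :: "('a, 'b) monoid_scheme"
  assumes "group G" and "finite (carrier G)"
  shows "\<exists>(a::nat) (b::nat). \<exists>\<phi> \<in> iso (B_group G)
             (product_group {..<a} (\<lambda>_. integer_group) \<times>\<times>
              product_group {..<b} (\<lambda>_. integer_mod_group 2)).
           \<phi> ` {\<alpha> \<in> carrier (B_group G). self_inverse_tuple G (reduced_form G \<alpha>)} =
             {\<one>\<^bsub>product_group {..<a} (\<lambda>_. integer_group)\<^esub>} \<times>
             carrier (product_group {..<b} (\<lambda>_. integer_mod_group 2)) \<and>
           {\<alpha> \<in> carrier (B_group G). self_inverse_tuple G (reduced_form G \<alpha>)} =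
             {\<alpha> \<in> carrier (B_group G). \<alpha> \<otimes>\<^bsub>B_group G\<^esub> \<alpha> = \<one>\<^bsub>B_group G\<^esub>}"
proof -
  interpret group G by fact
  let ?B = "B_group G" and ?cG = "carrier G"
  interpret B: comm_group ?B by (rule comm_group_B_group)
  let ?K = "{\<alpha> \<in> carrier ?B. self_inverse_tuple G (reduced_form G \<alpha>)}"
  let ?Z = "\<lambda>a::nat. product_group {..<a} (\<lambda>_. integer_group)"
  let ?Z2 = "\<lambda>b::nat. product_group {..<b} (\<lambda>_. integer_mod_group 2)"
  have K: "?K = {\<alpha> \<in> carrier ?B. \<alpha> \<otimes>\<^bsub>?B\<^esub> \<alpha> = \<one>\<^bsub>?B\<^esub>}"
    by (intro Collect_cong conj_cong refl self_inverse_iff_involution)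
  have Z0: "integer_mod_group 0 = integer_group" by (simp add: integer_mod_group_def)
  have kerZ: "{\<alpha> \<in> carrier ?B. \<forall>f\<in>signed_count ` ?cG. f \<alpha> = 0} = ?K"
    by (intro Collect_cong conj_cong refl) (simp add: self_inverse_iff_signed_count)
  have "\<exists>a::nat. splits_onto ?B (product_group {..<a} (\<lambda>_. integer_mod_group 0))
      {\<alpha> \<in> carrier ?B. \<forall>f\<in>signed_count ` ?cG. f \<alpha> = 0}"
    by (rule splits_onto_power_of_cyclic[OF comm_group_B_group])
      (use assms(2) signed_count_hom in \<open>auto simp: Z0\<close>)
  then obtain a where a: "splits_onto ?B (?Z a) ?K" unfolding Z0 kerZ by (rule exE)
  have "subgroup ?K ?B" unfolding K
    by (rule B.subgroupI) (auto simp: B.m_ac B.inv_mult[symmetric])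
  let ?BK = "?B\<lparr>carrier := ?K\<rparr>"
  have "group ?BK" by (rule B.subgroup_imp_group) fact
  then have cK: "comm_group ?BK"
    by (rule group.group_comm_groupI) (simp add: B.m_comm)
  have b_ex: "\<exists>b::nat. splits_onto ?BK (?Z2 b)
      {\<alpha> \<in> carrier ?BK. \<forall>f\<in>parity_count ` ?cG. f \<alpha> = 0}"
  proof (rule splits_onto_power_of_cyclic[OF cK])
    show "\<alpha> [^]\<^bsub>?BK\<^esub> (2::nat) = \<one>\<^bsub>?BK\<^esub>" if "\<alpha> \<in> carrier ?BK" for \<alpha>
      using that unfolding K by (simp add: numeral_2_eq_2 nat_pow_def)
    show "parity_count ` ?cG \<subseteq> hom ?BK (integer_mod_group 2)"
      using parity_count_hom by (auto simp: hom_def)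
  qed (use assms(2) in simp_all)
  have kerZ2: "{\<alpha> \<in> carrier ?BK. \<forall>f\<in>parity_count ` ?cG. f \<alpha> = 0} = {\<one>\<^bsub>?B\<^esub>}"
  proof (intro equalityI subsetI)
    fix \<alpha> assume "\<alpha> \<in> {\<alpha> \<in> carrier ?BK. \<forall>f\<in>parity_count ` ?cG. f \<alpha> = 0}"
    then have "\<alpha> \<in> carrier ?B" "self_inverse_tuple G (reduced_form G \<alpha>)"
      "\<And>x. x \<in> ?cG \<Longrightarrow> parity_count x \<alpha> = 0" by simp_all
    then show "\<alpha> \<in> {\<one>\<^bsub>?B\<^esub>}"
      using counts_eq_zero_imp_one self_inverse_iff_signed_count by simp
  next
    fix \<alpha> assume "\<alpha> \<in> {\<one>\<^bsub>?B\<^esub>}"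
    moreover have "parity_count x \<one>\<^bsub>?B\<^esub> = 0" if "x \<in> ?cG" for x
      using hom_one[OF parity_count_hom[OF that] B.is_group] by simp
    ultimately show "\<alpha> \<in> {\<alpha> \<in> carrier ?BK. \<forall>f\<in>parity_count ` ?cG. f \<alpha> = 0}"
      using self_inverse_iff_involution[of "\<one>\<^bsub>?B\<^esub>"] by simp
  qed
  from b_ex obtain b where b: "splits_onto ?BK (?Z2 b) {\<one>\<^bsub>?B\<^esub>}" unfolding kerZ2 by (rule exE)
  let ?H = "?Z a \<times>\<times> ?Z2 b"
  have gH: "group ?H" by (simp add: DirProd_group)
  have "splits_onto ?B ?H {\<one>\<^bsub>?B\<^esub>}"
    by (rule splits_onto_trans[OF comm_group_B_group _ _ a b]) simp_all
  then have "?B \<cong> ?H" by (rule splits_onto_trivial_kernel_iso[OF B.is_group gH _ refl])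
  then obtain \<phi> where \<phi>: "\<phi> \<in> iso ?B ?H" by (auto simp: is_iso_def)
  have "\<phi> ` ?K = {w \<in> carrier ?H. w \<otimes>\<^bsub>?H\<^esub> w = \<one>\<^bsub>?H\<^esub>}"
    unfolding K by (rule iso_image_involutions[OF B.is_group gH \<phi>])
  also have "\<dots> = {\<one>\<^bsub>?Z a\<^esub>} \<times> carrier (?Z2 b)"
  proof -
    have "u \<otimes>\<^bsub>?Z a\<^esub> u = \<one>\<^bsub>?Z a\<^esub> \<longleftrightarrow> u = \<one>\<^bsub>?Z a\<^esub>" if "u \<in> carrier (?Z a)" for u
      using that by (auto simp: fun_eq_iff PiE_iff extensional_def)
    moreover have "v \<otimes>\<^bsub>?Z2 b\<^esub> v = \<one>\<^bsub>?Z2 b\<^esub>" for v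
      by (simp add: fun_eq_iff)
    moreover have "\<one>\<^bsub>?Z a\<^esub> \<in> carrier (?Z a)" by simp
    ultimately show ?thesis by (auto simp del: one_product_group mult_product_group carrier_product_group)
  qed
  finally show ?thesis using \<phi> K by (intro exI[of _ a] exI[of _ b] bexI[of _ \<phi>] conjI)
qed

end
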